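(* For all $s\in\mathbb{C}$, $$(1-2^{1-s})\,\zeta^{-}(s)=2^{s-1}\int_{-\pi/2}^{\pi/2}\frac{e^{-(\pi/2)\sin\theta}\,\sin\bigl((\pi/2)\cos\theta+\theta(s-1)\bigr)}{\cosh(\pi\sin\theta)-\cos(\pi\cos\theta)}\,d\theta .$$
   Context: The lower incomplete zeta function $\zeta^{-}$ is defined for $\Re(s)<0$ by $$\zeta^{-}(s)=\frac{2^{s-1}\sin(\pi s/2)}{2^{1-s}-1}\int_0^1\frac{v^{-s}}{\sinh(\pi v/2)}\,dv,$$ and for other $s$ by analytic continuation; the product $(1-2^{1-s})\zeta^{-}(s)$ (denoted $\eta^{-}(s)$ in the paper) is understood as its analytic continuation at points where $2^{1-s}=1$. *)

theory Defs
  imports "HOL-Complex_Analysis.Complex_Analysis"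
begin

definition zeta_minus_integral :: "complex \<Rightarrow> complex" where
  "zeta_minus_integral s =
     2 powr (s - 1) * sin (of_real pi * s / 2) / (2 powr (1 - s) - 1) *
     integral {0..1} (\<lambda>v::real. of_real v powr (-s) / of_real (sinh (pi * v / 2)))"

text \<open>
  The integral converges (absolutely) exactly for \<open>Re s < 0\<close>. The lower incomplete zeta function is
  the meromorphic continuation of this function from the half-plane \<open>Re s < 0\<close> to the whole
  plane; as in the library notion of a nicely meromorphic function, its value at a pole is 0 and
  it has no removable singularities. By the identity theorem there is at most one such function.
\<close>

definition zeta_minus :: "complex \<Rightarrow> complex" where
  "zeta_minus = (THE f. f nicely_meromorphic_on UNIV \<and>
                        (\<forall>s. Re s < 0 \<longrightarrow> f s = zeta_minus_integral s))"

text \<open>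
  The product \<open>(1 - 2 powr (1 - s)) * zeta_minus s\<close>, where at a zero of the first factor the
  function is continued analytically (\<open>zeta_minus\<close> may have a pole there).
\<close>

definition eta_minus :: "complex \<Rightarrow> complex" where
  "eta_minus s =
     (if 2 powr (1 - s) = 1
      then remove_sings (\<lambda>z. (1 - 2 powr (1 - z)) * zeta_minus z) s
      else (1 - 2 powr (1 - s)) * zeta_minus s)"

end

theory Submission
  imports Defs
begin

text \<open>
  In the half-plane \<open>Re s < 0\<close> the claim is a single application of Cauchy's theorem. The function
  \<open>z powr (-s) / sin (pi * z / 2)\<close> is holomorphic on the right half of the punctured unit disc. Its
  integrals along the two radii from \<open>-\<i>\<close> to \<open>0\<close> and from \<open>0\<close> to \<open>\<i>\<close> add up to
  \<open>-2 * \<i> * sin (pi * s / 2)\<close> times the integral over \<open>v\<close> that defines \<open>zeta_minus\<close>, and they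
  equal the integral along the unit semicircle \<open>exp (\<i> * \<theta>)\<close>
  (\<open>arc_integral_eq_radial_integral\<close>). Expanding the reciprocal of the sine over the semicircle and folding
  \<open>\<theta>\<close> with \<open>-\<theta>\<close> turns the latter into the integral of the claim
  (\<open>arc_integral_symmetrised\<close>).

  The semicircle stays away from the singularity at \<open>0\<close>, so its integral is entire in \<open>s\<close>
  (\<open>arc_integral_holomorphic\<close>). Dividing it by \<open>1 - 2 powr (1 - s)\<close> therefore exhibits the
  meromorphic continuation of \<open>zeta_minus_integral\<close>, which is unique by the identity theorem
  (\<open>nicely_meromorphic_eqI\<close>). Multiplying the factor back gives the claim wherever the factor is
  nonzero; its zeros are isolated, so continuity of the right-hand side settles the remaining points.
\<close>

section \<open>The semicircle integral\<close>

text \<open>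
  The substitution \<open>z = exp w\<close> replaces \<open>z powr (-s) / sin (pi * z / 2) dz\<close> by this kernel. It has no
  branch cut and is holomorphic on a whole half-plane, hence has a primitive there; the semicircle
  becomes the segment from \<open>-\<i> * pi / 2\<close> to \<open>\<i> * pi / 2\<close>, and the two radii become horizontal rays.
\<close>
definition arc_kernel :: "complex \<Rightarrow> complex \<Rightarrow> complex" where
  "arc_kernel s w = exp ((1 - s) * w) / sin (of_real pi * exp w / 2)"

definition arc_integral :: "complex \<Rightarrow> complex" where
  "arc_integral s = integral {-(pi / 2)..pi / 2} (\<lambda>\<theta>. arc_kernel s (\<i> * of_real \<theta>))"

text \<open>The zeros of \<open>sin (pi * z / 2)\<close> are the even integers, so \<open>z = 0\<close> is the only one with
  \<open>norm z < 2\<close>, and \<open>exp w\<close> never takes that value.\<close>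
lemma sin_half_pi_exp_nonzero:
  assumes "Re w < ln 2"
  shows "sin (of_real pi * exp w / 2) \<noteq> 0"
proof
  assume "sin (of_real pi * exp w / 2) = 0"
  then obtain n :: int where n: "of_real pi * exp w / 2 = of_real (n * pi)"
    unfolding sin_eq_0 by blast
  then have "n \<noteq> 0"
    by auto
  then have "pi \<le> \<bar>of_int n\<bar> * pi"
    by simp
  also have "\<dots> = norm (of_real pi * exp w / 2)"
    unfolding n by (simp add: norm_mult abs_mult)
  also have "\<dots> = pi / 2 * exp (Re w)"
    by (simp add: norm_mult)
  finally have "2 \<le> exp (Re w)"
    by simp
  then show False
    using assms by (metis exp_gt_zero ln_exp ln_mono not_le zero_less_numeral)
qed

lemma arc_kernel_integrable:
  "(\<lambda>\<theta>. arc_kernel s (\<i> * of_real \<theta>)) integrable_on {a..b}"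
  unfolding arc_kernel_def
  by (intro integrable_continuous_real continuous_intros ballI sin_half_pi_exp_nonzero) simp_all

lemma arc_integral_holomorphic: "arc_integral holomorphic_on A"
proof -
  have "(\<lambda>s. integral (cbox (-(pi / 2)) (pi / 2)) (\<lambda>\<theta>. arc_kernel s (\<i> * of_real \<theta>))) holomorphic_on UNIV"
  proof (rule leibniz_rule_holomorphic)
    fix s :: complex and \<theta> :: real
    show "((\<lambda>s. arc_kernel s (\<i> * of_real \<theta>)) has_field_derivative
            - (\<i> * of_real \<theta>) * arc_kernel s (\<i> * of_real \<theta>)) (at s within UNIV)"
      unfolding arc_kernel_def
      by (auto intro!: derivative_eq_intros sin_half_pi_exp_nonzero simp: field_simps)
  next
    show "continuous_on (UNIV \<times> cbox (-(pi / 2)) (pi / 2))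
            (\<lambda>(s, \<theta>). - (\<i> * of_real \<theta>) * arc_kernel s (\<i> * of_real \<theta>))"
      unfolding arc_kernel_def case_prod_unfold
      by (intro continuous_intros sin_half_pi_exp_nonzero ballI) simp_all
  qed (use arc_kernel_integrable in auto)
  then have "arc_integral holomorphic_on UNIV"
    by (simp add: arc_integral_def [abs_def])
  then show ?thesis
    by (rule holomorphic_on_subset) simp
qed

text \<open>
  With \<open>u = pi / 2 * exp (\<i> * \<theta>)\<close>, expanding \<open>1 / sin u\<close> by \<open>sin (cnj u)\<close> gives the real denominator
  \<open>2 * sin u * sin (cnj u) = cosh (pi * sin \<theta>) - cos (pi * cos \<theta>)\<close>, which is even in \<open>\<theta>\<close>. The
  numerators of the two integrands are different functions of \<open>\<theta>\<close>, but up to the factor 2 they have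
  the same even part, and only that part matters on a symmetric interval.
\<close>
lemma arc_integral_symmetrised:
  "arc_integral s = 2 * integral {-(pi / 2)..pi / 2}
      (\<lambda>\<theta>::real.
         of_real (exp (-(pi / 2) * sin \<theta>)) *
         sin (of_real (pi / 2 * cos \<theta>) + of_real \<theta> * (s - 1)) /
         of_real (cosh (pi * sin \<theta>) - cos (pi * cos \<theta>)))"
    (is "_ = 2 * integral ?I ?K")
proof -
  define f where "f = (\<lambda>\<theta>. arc_kernel s (\<i> * of_real \<theta>))"
  define D where "D = (\<lambda>\<theta>. complex_of_real (cosh (pi * sin \<theta>) - cos (pi * cos \<theta>)))"
  have D: "D \<theta> \<noteq> 0"
    and f: "f \<theta> = exp (\<i> * of_real \<theta> * (1 - s)) *
      (2 * sin (of_real (pi / 2 * cos \<theta>) - \<i> * of_real (pi / 2 * sin \<theta>))) / D \<theta>" for \<theta>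
  proof -
    define u where "u = of_real (pi / 2 * cos \<theta>) + \<i> * of_real (pi / 2 * sin \<theta>)"
    have u: "of_real pi * exp (\<i> * of_real \<theta>) / 2 = u"
      by (simp add: u_def exp_Euler cos_of_real sin_of_real algebra_simps)
    have cu: "cnj u = of_real (pi / 2 * cos \<theta>) - \<i> * of_real (pi / 2 * sin \<theta>)"
      by (simp add: u_def)
    have nz: "sin u \<noteq> 0" "sin (cnj u) \<noteq> 0"
      using sin_half_pi_exp_nonzero [of "\<i> * of_real \<theta>"] unfolding u by (simp_all flip: cnj_sin)
    have ch: "cos (\<i> * of_real x) = of_real (cosh x)" for x
      using exp_of_real [of "-x", where 'a = complex]
      by (simp add: cos_exp_eq cosh_field_def exp_of_real field_simps)
    have "2 * (sin u * sin (cnj u)) = cos (u - cnj u) - cos (u + cnj u)"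
      by (simp add: cos_diff cos_add)
    also have "u - cnj u = \<i> * of_real (pi * sin \<theta>)"
      unfolding cu unfolding u_def by (simp add: field_simps)
    also have "cos \<dots> = of_real (cosh (pi * sin \<theta>))"
      by (rule ch)
    also have "u + cnj u = of_real (pi * cos \<theta>)"
      unfolding cu unfolding u_def by (simp add: field_simps)
    also have "cos \<dots> = of_real (cos (pi * cos \<theta>))"
      by (rule cos_of_real)
    finally have Du: "D \<theta> = 2 * (sin u * sin (cnj u))"
      by (simp add: D_def)
    show "D \<theta> \<noteq> 0"
      using nz by (simp add: Du)
    show "f \<theta> = exp (\<i> * of_real \<theta> * (1 - s)) *
      (2 * sin (of_real (pi / 2 * cos \<theta>) - \<i> * of_real (pi / 2 * sin \<theta>))) / D \<theta>"
      unfolding f_def arc_kernel_def u Du cu [symmetric] using nz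
      by (simp add: field_simps)
  qed
  have fold: "f \<theta> + f (-\<theta>) = 2 * (?K \<theta> + ?K (-\<theta>))" for \<theta>
  proof -
    define p where "p = complex_of_real (pi / 2 * cos \<theta>)"
    define q where "q = complex_of_real (pi / 2 * sin \<theta>)"
    define r where "r = of_real \<theta> * (s - 1)"
    have D_minus: "D (-\<theta>) = D \<theta>"
      by (simp add: D_def)
    have "exp (- (\<i> * r)) * (2 * sin (p - \<i> * q)) + exp (\<i> * r) * (2 * sin (p + \<i> * q)) =
        2 * (exp (- q) * sin (p + r) + exp q * sin (p - r))"
      by (simp add: sin_exp_eq exp_add exp_diff exp_minus field_simps)
    then have "(exp (- (\<i> * r)) * (2 * sin (p - \<i> * q)) + exp (\<i> * r) * (2 * sin (p + \<i> * q))) / D \<theta> =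
        2 * ((exp (- q) * sin (p + r) + exp q * sin (p - r)) / D \<theta>)"
      by simp
    moreover have "f \<theta> = exp (- (\<i> * r)) * (2 * sin (p - \<i> * q)) / D \<theta>"
      by (simp add: f p_def q_def r_def algebra_simps)
    moreover have "f (-\<theta>) = exp (\<i> * r) * (2 * sin (p + \<i> * q)) / D \<theta>"
      by (simp add: f D_minus p_def q_def r_def algebra_simps)
    moreover have "?K \<theta> = exp (- q) * sin (p + r) / D \<theta>"
      using exp_of_real [of "- (pi / 2 * sin \<theta>)", where 'a = complex]
      by (simp add: D_def p_def q_def r_def)
    moreover have "?K (-\<theta>) = exp q * sin (p - r) / D \<theta>"
      using exp_of_real [of "pi / 2 * sin \<theta>", where 'a = complex]
      by (simp add: D_def p_def q_def r_def)
    ultimately show ?thesis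
      by (simp only: add_divide_distrib)
  qed
  have "?K integrable_on ?I"
    by (intro integrable_continuous_real continuous_intros) (use D in \<open>simp add: D_def\<close>)
  moreover have "f integrable_on ?I"
    unfolding f_def by (rule arc_kernel_integrable)
  moreover have fold_integral: "integral ?I (\<lambda>\<theta>. g \<theta> + g (-\<theta>)) = 2 * integral ?I g"
    if "g integrable_on ?I" for g :: "real \<Rightarrow> complex"
    using that Henstock_Kurzweil_Integration.integral_reflect_real [of "pi / 2" "-(pi / 2)" g]
      Henstock_Kurzweil_Integration.integrable_reflect_real [of g "pi / 2" "-(pi / 2)"]
    by (simp add: Henstock_Kurzweil_Integration.integral_add)
  ultimately have "2 * integral ?I f = 2 * (2 * integral ?I ?K)"
    by (simp only: fold Henstock_Kurzweil_Integration.integral_mult_right flip: fold_integral)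
  then show ?thesis
    by (simp add: arc_integral_def f_def)
qed

section \<open>Cauchy's theorem on the half disc\<close>

lemma half_norm_le_norm_sin:
  obtains \<delta> where "\<delta> > 0" "\<And>u::complex. norm u < \<delta> \<Longrightarrow> norm u / 2 \<le> norm (sin u)"
proof -
  have "((\<lambda>u::complex. norm (sin u / u)) \<longlongrightarrow> norm (1::complex)) (at 0)"
    using DERIV_sin [of "0::complex"] by (intro tendsto_norm) (simp add: has_field_derivative_iff)
  then have "eventually (\<lambda>u::complex. 1 / 2 < norm (sin u / u)) (at 0)"
    by (rule order_tendstoD) simp
  then obtain \<delta> where \<delta>: "\<delta> > 0" "\<And>u::complex. u \<noteq> 0 \<Longrightarrow> norm u < \<delta> \<Longrightarrow> 1 / 2 < norm (sin u / u)"
    by (auto simp: eventually_at)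
  have "norm u / 2 \<le> norm (sin u)" if "norm u < \<delta>" for u :: complex
    using \<delta>(2)[OF _ that] by (cases "u = 0") (auto simp: norm_divide field_simps)
  with \<delta>(1) show ?thesis
    by (rule that)
qed

text \<open>
  Near \<open>Re w = -\<infinity>\<close> (that is, near \<open>z = 0\<close>) the sine in the denominator is comparable to \<open>exp w\<close>, which
  leaves \<open>exp (- s * w)\<close>. For \<open>Re s < 0\<close> this bound tends to 0, so the small semicircle that cuts
  off the singularity contributes nothing in the limit.
\<close>
lemma arc_kernel_decay:
  obtains C \<delta> where "\<delta> > 0"
    "\<And>w. exp (Re w) < \<delta> \<Longrightarrow> \<bar>Im w\<bar> \<le> pi / 2 \<Longrightarrow>
       norm (arc_kernel s w) \<le> C * exp (- Re s * Re w)"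
proof -
  obtain \<epsilon> where \<epsilon>: "\<epsilon> > 0" "\<And>u::complex. norm u < \<epsilon> \<Longrightarrow> norm u / 2 \<le> norm (sin u)"
    using half_norm_le_norm_sin by blast
  define C where "C = 4 / pi * exp (\<bar>Im s\<bar> * (pi / 2))"
  have "norm (arc_kernel s w) \<le> C * exp (- Re s * Re w)"
    if w: "exp (Re w) < \<epsilon> / 2" "\<bar>Im w\<bar> \<le> pi / 2" for w
  proof -
    define v where "v = exp (Re w)"
    have v: "v > 0" "v < \<epsilon> / 2"
      using w by (simp_all add: v_def)
    have r: "norm (of_real pi * exp w / 2) = pi / 2 * v"
      by (simp add: v_def norm_mult norm_divide)
    have "pi / 2 * v \<le> 2 * v"
      using pi_less_4 v by simp
    then have "norm (of_real pi * exp w / 2) < \<epsilon>"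
      using v unfolding r by linarith
    from \<epsilon>(2) [OF this] have l: "pi / 4 * v \<le> norm (sin (of_real pi * exp w / 2))"
      unfolding r by simp
    have "Im s * Im w \<le> \<bar>Im s\<bar> * \<bar>Im w\<bar>"
      by (metis abs_ge_self abs_mult)
    also have "\<dots> \<le> \<bar>Im s\<bar> * (pi / 2)"
      using w by (intro mult_left_mono) auto
    finally have "norm (exp ((1 - s) * w)) \<le> exp (Re w + - Re s * Re w + \<bar>Im s\<bar> * (pi / 2))"
      by (simp add: algebra_simps)
    also have "\<dots> = v * exp (- Re s * Re w) * exp (\<bar>Im s\<bar> * (pi / 2))"
      by (simp only: exp_add v_def)
    finally have "norm (arc_kernel s w) \<le>
        (v * exp (- Re s * Re w) * exp (\<bar>Im s\<bar> * (pi / 2))) / (pi / 4 * v)"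
      unfolding arc_kernel_def norm_divide using v l by (intro frac_le) auto
    also have "\<dots> = C * exp (- Re s * Re w)"
      using v by (simp add: C_def field_simps)
    finally show ?thesis .
  qed
  with \<epsilon>(1) show ?thesis
    by (intro that [of "\<epsilon> / 2" C]) auto
qed

text \<open>
  The point \<open>z = \<plusminus> \<i> * v\<close> of a radius corresponds to \<open>w = ln v \<plusminus> \<i> * pi / 2\<close>, with \<open>\<sigma>\<close> as the sign.
  The factor \<open>1 / v\<close> is the derivative of \<open>ln v\<close>.
\<close>
lemma arc_kernel_radius:
  assumes "v > 0" "\<sigma> \<in> {1,-1}"
  shows "arc_kernel s (of_real (ln v) + \<sigma> * (\<i> * of_real (pi / 2))) / of_real v =
    exp (- \<sigma> * (\<i> * (of_real pi * s / 2))) * (of_real v powr (-s) / of_real (sinh (pi * v / 2)))"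
proof -
  define w where "w = of_real (ln v) + \<sigma> * (\<i> * of_real (pi / 2))"
  have e: "exp w = \<sigma> * \<i> * of_real v"
  proof -
    have "exp (\<sigma> * (\<i> * of_real (pi / 2))) = \<sigma> * \<i>"
      using assms by (auto simp: exp_Euler exp_minus cos_of_real sin_of_real simp del: of_real_divide)
    then show ?thesis
      using assms by (simp add: w_def exp_add exp_of_real del: of_real_divide)
  qed
  have "exp ((1 - s) * w) = exp w * exp (- s * w)"
    by (simp add: exp_add [symmetric] algebra_simps)
  also have "exp (- s * w) =
      of_real v powr (-s) * exp (- \<sigma> * (\<i> * (of_real pi * s / 2)))"
    using assms by (simp add: powr_def Ln_of_real exp_add [symmetric] w_def algebra_simps)
  finally have n: "exp ((1 - s) * w) =
    \<sigma> * \<i> * of_real v * (of_real v powr (-s) * exp (- \<sigma> * (\<i> * (of_real pi * s / 2))))"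
    by (simp add: e)
  have sh: "sin (\<i> * of_real x) = \<i> * of_real (sinh x)" for x
    using exp_of_real [of "-x", where 'a = complex]
    by (simp add: sin_exp_eq sinh_field_def exp_of_real field_simps)
  have d: "sin (of_real pi * exp w / 2) = \<sigma> * \<i> * of_real (sinh (pi * v / 2))"
    using assms sh [of "pi * v / 2"] unfolding e by (auto simp: field_simps)
  show ?thesis
    unfolding arc_kernel_def w_def [symmetric] n d using assms by (auto simp: field_simps)
qed

text \<open>
  Cauchy's theorem is used in the form of a primitive \<open>\<Phi>\<close> of the kernel. The difference of \<open>\<Phi>\<close> between
  the two radii is an antiderivative of the integrand on the left and, at \<open>v = 1\<close>, equals the
  semicircle integral. The fundamental theorem of calculus needs differentiability only in the
  interior, so it also yields the convergence of the improper integral at \<open>v = 0\<close>.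
\<close>
lemma radii_has_integral:
  assumes "Re s < 0"
  shows "((\<lambda>v. -2 * \<i> * sin (of_real pi * s / 2) *
            (of_real v powr (-s) / of_real (sinh (pi * v / 2)))) has_integral
          \<i> * arc_integral s) {0..1}"
proof -
  define S where "S = {w. Re w < ln 2}"
  have S: "open S" "convex S"
    unfolding S_def by (simp_all add: open_halfspace_Re_lt convex_halfspace_Re_lt)
  have "arc_kernel s holomorphic_on S"
    unfolding arc_kernel_def S_def
    by (intro holomorphic_intros) (use sin_half_pi_exp_nonzero in auto)
  then obtain \<Phi> where "\<And>w. w \<in> S \<Longrightarrow> (\<Phi> has_field_derivative arc_kernel s w) (at w within S)"
    using holomorphic_convex_primitive' S by blast
  then have \<Phi>: "(\<Phi> has_field_derivative arc_kernel s w) (at w)" if "w \<in> S" for w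
    using S(1) that by (metis at_within_open)
  define edge where "edge = (\<lambda>\<sigma> v. of_real (ln v) + \<sigma> * (\<i> * of_real (pi / 2)) :: complex)"
  \<comment> \<open>The integral over the semicircle of radius \<open>v\<close>, expressed by \<open>\<Phi>\<close>. The value 0 at
    \<open>v = 0\<close>, where \<open>ln\<close> carries no information, is the continuous extension.\<close>
  define B where "B = (\<lambda>v. if v = 0 then 0 else \<Phi> (edge 1 v) - \<Phi> (edge (-1) v))"
  have edge_S: "edge \<sigma> v \<in> S" if "v > 0" "v \<le> 1" "\<sigma> \<in> {1,-1}" for \<sigma> v
  proof -
    have "ln v < ln 2" using that by simp
    then show ?thesis using that unfolding edge_def S_def by auto
  qed
  have edge_deriv: "((\<lambda>v. \<Phi> (edge \<sigma> v)) has_vector_derivative arc_kernel s (edge \<sigma> v) / of_real v) (at v)"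
    if "v > 0" "v \<le> 1" "\<sigma> \<in> {1,-1}" for \<sigma> v
  proof -
    have "(edge \<sigma> has_vector_derivative of_real (1 / v)) (at v)"
      unfolding edge_def using that
      by (auto intro!: derivative_eq_intros has_vector_derivative_of_real DERIV_ln_divide
            simp: has_real_derivative_iff_has_vector_derivative [symmetric])
    from field_vector_diff_chain_at [OF this \<Phi> [OF edge_S [OF that]]] show ?thesis
      by (simp add: o_def divide_inverse mult.commute)
  qed
  have "(B has_vector_derivative -2 * \<i> * sin (of_real pi * s / 2) *
          (of_real v powr (-s) / of_real (sinh (pi * v / 2)))) (at v)" if "v \<in> {0<..<1}" for v
  proof -
    have "((\<lambda>v. \<Phi> (edge 1 v) - \<Phi> (edge (-1) v)) has_vector_derivative
        arc_kernel s (edge 1 v) / of_real v - arc_kernel s (edge (-1) v) / of_real v) (at v)"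
      by (intro has_vector_derivative_diff edge_deriv) (use that in auto)
    also have "arc_kernel s (edge 1 v) / of_real v - arc_kernel s (edge (-1) v) / of_real v =
       -2 * \<i> * sin (of_real pi * s / 2) * (of_real v powr (-s) / of_real (sinh (pi * v / 2)))"
    proof -
      define y where "y = of_real pi * s / 2"
      define A where "A = of_real v powr (-s) / complex_of_real (sinh (pi * v / 2))"
      have "arc_kernel s (edge 1 v) / of_real v = exp (- (\<i> * y)) * A"
           "arc_kernel s (edge (-1) v) / of_real v = exp (\<i> * y) * A"
        using arc_kernel_radius [of v 1 s] arc_kernel_radius [of v "-1" s] that
        by (simp_all add: y_def A_def edge_def)
      moreover have "exp (- (\<i> * y)) - exp (\<i> * y) = -2 * \<i> * sin y"
        by (simp add: sin_exp_eq)
      ultimately show ?thesis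
        unfolding y_def A_def by (simp only: flip: left_diff_distrib)
    qed
    finally show ?thesis
      by (rule has_vector_derivative_transform_within_open [where S = "{0<..}"])
         (use that in \<open>auto simp: B_def\<close>)
  qed
  moreover have "continuous_on {0..1} B"
  proof -
    have "isCont B v" if "v \<in> {0<..1}" for v
    proof -
      have "isCont (\<lambda>v. \<Phi> (edge 1 v) - \<Phi> (edge (-1) v)) v"
        by (intro continuous_intros has_vector_derivative_continuous [OF edge_deriv]) (use that in auto)
      moreover have "eventually (\<lambda>v. B v = \<Phi> (edge 1 v) - \<Phi> (edge (-1) v)) (nhds v)"
        by (rule eventually_mono [OF eventually_nhds_in_open [of "{0<..}" v]])
           (use that in \<open>auto simp: B_def\<close>)
      ultimately show ?thesis
        by (simp only: isCont_cong)
    qed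
    moreover have "continuous (at 0 within {0..1}) B"
    proof -
      obtain C \<delta> where \<delta>: "\<delta> > 0"
        "\<And>w. exp (Re w) < \<delta> \<Longrightarrow> \<bar>Im w\<bar> \<le> pi / 2 \<Longrightarrow>
           norm (arc_kernel s w) \<le> C * exp (- Re s * Re w)"
        using arc_kernel_decay by blast
      have bound: "norm (B v) \<le> C * pi * v powr (- Re s)" if "v > 0" "v \<le> 1" "v < \<delta>" for v
      proof -
        define T where "T = {w. Re w \<ge> ln v} \<inter> {w. Re w \<le> ln v} \<inter>
          {w. Im w \<ge> -(pi / 2)} \<inter> {w. Im w \<le> pi / 2}"
        have T: "convex T"
          unfolding T_def by (intro convex_Int convex_halfspace_Re_ge convex_halfspace_Re_le
            convex_halfspace_Im_ge convex_halfspace_Im_le)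
        have TS: "w \<in> S" if "w \<in> T" for w
        proof -
          have "ln v < ln 2"
            using \<open>v > 0\<close> \<open>v \<le> 1\<close> by simp
          then show ?thesis
            using that unfolding T_def S_def by auto
        qed
        have decay: "norm (arc_kernel s w) \<le> C * v powr (- Re s)" if "w \<in> T" for w
        proof -
          have w: "Re w = ln v" "\<bar>Im w\<bar> \<le> pi / 2"
            using that unfolding T_def by auto
          then show ?thesis
            using \<delta>(2) [of w] \<open>v > 0\<close> \<open>v < \<delta>\<close> by (simp add: powr_def)
        qed
        \<comment> \<open>The segment \<open>T\<close> is the small semicircle; the mean value inequality bounds its integral by
          the length \<open>pi\<close> times the bound for the kernel.\<close>
        have "norm (\<Phi> (edge 1 v) - \<Phi> (edge (-1) v)) \<le> C * v powr (- Re s) * norm (edge 1 v - edge (-1) v)"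
          by (rule field_differentiable_bound [OF T DERIV_subset [OF \<Phi> [OF TS]] decay])
             (auto simp: T_def edge_def)
        also have "norm (edge 1 v - edge (-1) v) = pi"
          by (simp add: edge_def norm_mult)
        finally show ?thesis
          using that by (simp add: B_def mult_ac)
      qed
      have "((\<lambda>v. C * pi * v powr (- Re s)) \<longlongrightarrow> C * pi * 0) (at 0 within {0..1})"
        using assms by (intro tendsto_intros tendsto_zero_powrI) (auto intro!: tendsto_eq_intros simp: eventually_at_filter)
      moreover have "eventually (\<lambda>v. norm (B v) \<le> C * pi * v powr (- Re s)) (at 0 within {0..1})"
        unfolding eventually_at using bound \<delta>(1)
        by (intro exI [of _ \<delta>]) (auto simp: dist_real_def)
      ultimately have "(B \<longlongrightarrow> 0) (at 0 within {0..1})"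
        using Lim_null_comparison by force
      then show ?thesis
        by (simp add: continuous_within B_def)
    qed
    ultimately show ?thesis
      unfolding continuous_on_eq_continuous_within
      by (metis atLeastAtMost_iff continuous_at_imp_continuous_at_within greaterThanAtMost_iff less_eq_real_def)
  qed
  ultimately have "((\<lambda>v. -2 * \<i> * sin (of_real pi * s / 2) *
        (of_real v powr (-s) / of_real (sinh (pi * v / 2)))) has_integral (B 1 - B 0)) {0..1}"
    by (intro fundamental_theorem_of_calculus_interior) auto
  moreover have "B 1 - B 0 = \<i> * arc_integral s"
  proof -
    have "((\<lambda>\<theta>. arc_kernel s (\<i> * of_real \<theta>) * \<i>) has_integral
        \<Phi> (\<i> * of_real (pi / 2)) - \<Phi> (\<i> * of_real (-(pi / 2)))) {-(pi / 2)..pi / 2}"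
    proof (rule fundamental_theorem_of_calculus)
      fix \<theta> :: real
      have "((\<lambda>\<theta>. \<i> * of_real \<theta>) has_vector_derivative \<i>) (at \<theta>)"
        by (auto intro!: derivative_eq_intros)
      from field_vector_diff_chain_at [OF this \<Phi>]
      show "((\<lambda>\<theta>. \<Phi> (\<i> * of_real \<theta>)) has_vector_derivative arc_kernel s (\<i> * of_real \<theta>) * \<i>)
              (at \<theta> within {-(pi / 2)..pi / 2})"
        by (simp add: o_def S_def mult.commute has_vector_derivative_at_within)
    qed simp
    then have "arc_integral s * \<i> = \<Phi> (\<i> * of_real (pi / 2)) - \<Phi> (\<i> * of_real (-(pi / 2)))"
      unfolding arc_integral_def by (metis Henstock_Kurzweil_Integration.integral_mult_left integral_unique)
    then show ?thesis
      by (simp add: B_def edge_def mult.commute)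
  qed
  ultimately show ?thesis
    by simp
qed

lemma arc_integral_eq_radial_integral:
  assumes "Re s < 0"
  shows "arc_integral s =
    -2 * sin (of_real pi * s / 2) *
      integral {0..1} (\<lambda>v. of_real v powr (-s) / of_real (sinh (pi * v / 2)))"
proof -
  have "\<i> * arc_integral s = (-2 * \<i> * sin (of_real pi * s / 2)) *
      integral {0..1} (\<lambda>v. of_real v powr (-s) / of_real (sinh (pi * v / 2)))"
    using integral_unique [OF radii_has_integral [OF assms]]
    by (simp only: Henstock_Kurzweil_Integration.integral_mult_right)
  then have "\<i> * arc_integral s = \<i> * (-2 * sin (of_real pi * s / 2) *
      integral {0..1} (\<lambda>v. of_real v powr (-s) / of_real (sinh (pi * v / 2))))"
    by (simp only: mult_ac)
  then show ?thesis
    by (rule mult_left_cancel [OF complex_i_not_zero, THEN iffD1])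
qed

section \<open>Continuation to the plane\<close>

lemma eventually_nonzero_of_nonzero_value:
  assumes "g holomorphic_on UNIV" "g a \<noteq> 0"
  shows "eventually (\<lambda>w. g w \<noteq> 0) (at z)"
  using non_zero_neighbour_alt [of g UNIV z a] assms
  by (auto simp: eventually_at_filter elim: eventually_mono)

text \<open>
  The identity theorem makes both functions agree near every point up to the point itself, and
  niceness determines the value there: the limit, or 0 at a pole.
\<close>
lemma nicely_meromorphic_eqI:
  assumes f: "f nicely_meromorphic_on UNIV" and g: "g nicely_meromorphic_on UNIV"
    and ev: "eventually (\<lambda>z. f z = g z) (at a)"
  shows "f = g"
proof
  fix z
  have "(\<lambda>z. f z - g z) meromorphic_on UNIV"
    using f g by (intro meromorphic_intros) (auto simp: nicely_meromorphic_on_def)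
  then have "eventually (\<lambda>z. f z - g z = 0) (cosparse UNIV) \<or> eventually (\<lambda>z. f z - g z \<noteq> 0) (cosparse UNIV)"
    by (rule meromorphic_imp_constant_or_avoid) auto
  moreover have False if "eventually (\<lambda>z. f z - g z \<noteq> 0) (cosparse UNIV)"
  proof -
    have "eventually (\<lambda>z. f z - g z \<noteq> 0) (at a)"
      using that by (simp add: eventually_cosparse_imp_eventually_at)
    with ev have "eventually (\<lambda>_. False) (at a)"
      by eventually_elim simp
    then show False
      by simp
  qed
  ultimately have "eventually (\<lambda>z. f z - g z = 0) (at z)"
    using eventually_cosparse_imp_eventually_at by blast
  then have eq: "eventually (\<lambda>z. f z = g z) (at z)"
    by simp
  have "is_pole f z \<longleftrightarrow> is_pole g z"
    using eq by (intro is_pole_cong) auto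
  moreover have "f \<midarrow>z\<rightarrow> c \<longleftrightarrow> g \<midarrow>z\<rightarrow> c" for c
    using eq by (rule tendsto_cong)
  ultimately show "f z = g z"
    using f g unfolding nicely_meromorphic_on_def
    by (metis UNIV_I LIM_unique not_tendsto_and_filterlim_at_infinity at_neq_bot is_pole_def)
qed

theorem mainTheorem9:
  fixes s :: complex
  shows "eta_minus s =
    2 powr (s - 1) *
    integral {-(pi / 2)..pi / 2}
      (\<lambda>\<theta>::real.
         of_real (exp (-(pi / 2) * sin \<theta>)) *
         sin (of_real (pi / 2 * cos \<theta>) + of_real \<theta> * (s - 1)) /
         of_real (cosh (pi * sin \<theta>) - cos (pi * cos \<theta>)))"
proof -
  define E where "E = (\<lambda>s. 2 powr (s - 1) * (arc_integral s / 2))"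
  define d where "d = (\<lambda>s::complex. 1 - 2 powr (1 - s))"
  define Z where "Z = remove_sings (\<lambda>s. E s / d s)"
  have E: "E holomorphic_on UNIV" and d: "d holomorphic_on UNIV"
    unfolding E_def d_def by (intro holomorphic_intros arc_integral_holomorphic; simp)+
  have an: "E analytic_on A" "d analytic_on A" for A
    using E d analytic_on_holomorphic by blast+
  have mero: "(\<lambda>s. E s / d s) meromorphic_on UNIV"
    by (intro meromorphic_intros analytic_on_imp_meromorphic_on an)
  have Z_eq: "Z s = E s / d s" if "d s \<noteq> 0" for s
    unfolding Z_def using that by (intro remove_sings_at_analytic analytic_intros an) auto
  have left: "E s / d s = zeta_minus_integral s \<and> d s \<noteq> 0" if "Re s < 0" for s
  proof -
    have "norm (2 powr (1 - s)) = 2 powr (1 - Re s)"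
      by (simp add: norm_powr_real_powr)
    also have "\<dots> > 2 powr 0"
      using that by (subst powr_less_cancel_iff) auto
    finally have "2 powr (1 - s) \<noteq> 1"
      by auto
    then show ?thesis
      unfolding E_def d_def zeta_minus_integral_def arc_integral_eq_radial_integral [OF that]
      by (simp add: divide_simps) (simp add: algebra_simps)
  qed
  have "zeta_minus = Z"
    unfolding zeta_minus_def
  proof (rule the_equality)
    show "Z nicely_meromorphic_on UNIV \<and> (\<forall>s. Re s < 0 \<longrightarrow> Z s = zeta_minus_integral s)"
      using remove_sings_nicely_meromorphic [OF mero] left Z_eq by (auto simp: Z_def)
  next
    fix f assume f: "f nicely_meromorphic_on UNIV \<and> (\<forall>s. Re s < 0 \<longrightarrow> f s = zeta_minus_integral s)"
    have "eventually (\<lambda>s. s \<in> {s. Re s < 0}) (nhds (-1))"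
      by (rule eventually_nhds_in_open) (auto simp: open_halfspace_Re_lt)
    then have "eventually (\<lambda>s. f s = Z s) (at (-1))"
      unfolding eventually_at_filter by eventually_elim (use f left Z_eq in auto)
    then show "f = Z"
      using f remove_sings_nicely_meromorphic [OF mero] nicely_meromorphic_eqI unfolding Z_def by blast
  qed
  then have off: "d z * zeta_minus z = E z" if "d z \<noteq> 0" for z
    using Z_eq that by simp
  have "eta_minus s = E s"
  proof (cases "d s = 0")
    case True
    have "d (-1) \<noteq> 0"
      using left [of "-1"] by simp
    then have "eventually (\<lambda>z. d z \<noteq> 0) (at s)"
      using d eventually_nonzero_of_nonzero_value by blast
    then have ev: "eventually (\<lambda>z. d z * zeta_minus z = E z) (at s)"
      by eventually_elim (use off in auto)
    have "E \<midarrow>s\<rightarrow> E s"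
      using an(1) [of "{s}"] by (simp add: analytic_at_imp_isCont isContD)
    then have "(\<lambda>z. d z * zeta_minus z) \<midarrow>s\<rightarrow> E s"
      using tendsto_cong [OF ev] by simp
    then have "remove_sings (\<lambda>z. d z * zeta_minus z) s = E s"
      by (rule remove_sings_eqI)
    with True show ?thesis
      by (simp add: eta_minus_def d_def)
  next
    case False
    with off [OF False] show ?thesis
      by (simp add: eta_minus_def d_def)
  qed
  then show ?thesis
    by (simp add: E_def arc_integral_symmetrised)
qed

end
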